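(* Let $R$ be a commutative unitary ring and $x\in R$. Then, as operators on $\mathcal{S}(R)$, $$I^{(x)}=\mathcal{L}_{X(x)}\qquad\text{and}\qquad L^{(x)}=\mathcal{R}_{X(x)}.$$
   Context: Let $\mathcal{S}(R)$ be the set of sequences $A=\{a_n\}_{n=0}^{\infty}$ of elements of $R$ with $a_0=1$. For $A\in\mathcal{S}(R)$ put $\lambda(A)=\sum_{n\ge 0}a_nt^{n+1}\in R[[t]]$. Composition of series is $f\circ g=f(g(t))$, and $\mathcal{S}(R)$ is a group under $A\bullet B=\lambda^{-1}(\lambda(A)\circ\lambda(B))$. Left and right multiplication are $\mathcal{L}_A(B)=A\bullet B$ and $\mathcal{R}_A(B)=B\bullet A$. For $x\in R$, $X(x)=\{x^n\}_{n=0}^{\infty}\in\mathcal{S}(R)$. The interpolated Invert operator $I^{(x)}$ sends $A=\{a_n\}$ to the sequence with ordinary generating function $\dfrac{\sum_{n\ge0}a_nt^n}{1-xt\sum_{n\ge0}a_nt^n}$. The interpolated Binomial operator $L^{(x)}$ sends $A=\{a_n\}$ to $\{l_n\}_{n\ge0}$ with $l_n=\sum_{j=0}^n\binom{n}{j}x^{n-j}a_j$. *)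

theory Defs
  imports "HOL-Computational_Algebra.Formal_Power_Series" "HOL-Library.FuncSet"
begin

unbundle fps_syntax

definition seqs :: "(nat \<Rightarrow> 'a::comm_ring_1) set" where
  "seqs = {A. A 0 = 1}"

text \<open>\<open>lam A\<close> is the series \<open>\<Sum>n. a\<^sub>n t\<^sup>n\<^sup>+\<^sup>1\<close>; it carries \<open>seqs\<close> bijectively onto the series
  \<open>t + O(t\<^sup>2)\<close>, see \<open>bij_betw_lam\<close> below, so \<open>inv_into seqs lam\<close> is its inverse there.\<close>

definition lam :: "(nat \<Rightarrow> 'a::comm_ring_1) \<Rightarrow> 'a fps" where
  "lam A = Abs_fps (\<lambda>n. case n of 0 \<Rightarrow> 0 | Suc m \<Rightarrow> A m)"

definition bullet :: "(nat \<Rightarrow> 'a::comm_ring_1) \<Rightarrow> (nat \<Rightarrow> 'a) \<Rightarrow> nat \<Rightarrow> 'a" (infixl "\<bullet>\<^sub>S" 70) where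
  "A \<bullet>\<^sub>S B = inv_into seqs lam (lam A oo lam B)"

definition left_mult :: "(nat \<Rightarrow> 'a::comm_ring_1) \<Rightarrow> (nat \<Rightarrow> 'a) \<Rightarrow> nat \<Rightarrow> 'a" where
  "left_mult A B = A \<bullet>\<^sub>S B"

definition right_mult :: "(nat \<Rightarrow> 'a::comm_ring_1) \<Rightarrow> (nat \<Rightarrow> 'a) \<Rightarrow> nat \<Rightarrow> 'a" where
  "right_mult A B = B \<bullet>\<^sub>S A"

definition power_seq :: "'a::comm_ring_1 \<Rightarrow> nat \<Rightarrow> 'a" where
  "power_seq x = (\<lambda>n. x ^ n)"

text \<open>Division of power series is only available in the library over types with an \<open>inverse\<close>
  operation. Over a commutative ring, \<open>fps_right_inverse f 1\<close> is the multiplicative inverse of a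
  series \<open>f\<close> with constant coefficient \<open>1\<close>; see \<open>interp_invert_ogf\<close> below.\<close>

definition interp_invert :: "'a::comm_ring_1 \<Rightarrow> (nat \<Rightarrow> 'a) \<Rightarrow> nat \<Rightarrow> 'a" where
  "interp_invert x A =
     fps_nth (Abs_fps A * fps_right_inverse (1 - fps_const x * fps_X * Abs_fps A) 1)"

definition interp_binomial :: "'a::comm_ring_1 \<Rightarrow> (nat \<Rightarrow> 'a) \<Rightarrow> nat \<Rightarrow> 'a" where
  "interp_binomial x A = (\<lambda>n. \<Sum>j=0..n. of_nat (n choose j) * x ^ (n - j) * A j)"

lemma bij_betw_lam: "bij_betw lam seqs {f :: 'a::comm_ring_1 fps. f $ 0 = 0 \<and> f $ 1 = 1}"
proof (rule bij_betw_byWitness[where f' = "\<lambda>f n. f $ Suc n"])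
  show "\<forall>f\<in>{f :: 'a fps. f $ 0 = 0 \<and> f $ 1 = 1}. lam (\<lambda>n. f $ Suc n) = f"
    by (auto simp: lam_def fps_eq_iff split: nat.split)
qed (auto simp: lam_def seqs_def)

lemma bullet_in_seqs:
  fixes A B :: "nat \<Rightarrow> 'a::comm_ring_1"
  assumes "A \<in> seqs" "B \<in> seqs"
  shows "A \<bullet>\<^sub>S B \<in> seqs" and "lam (A \<bullet>\<^sub>S B) = lam A oo lam B"
proof -
  have "(lam A oo lam B) $ 0 = 0" "(lam A oo lam B) $ 1 = 1"
    using assms by (auto simp: lam_def seqs_def fps_compose_nth)
  then have "lam A oo lam B \<in> lam ` seqs"
    using bij_betw_imp_surj_on[OF bij_betw_lam[where 'a = 'a]] by auto
  then show "A \<bullet>\<^sub>S B \<in> seqs" and "lam (A \<bullet>\<^sub>S B) = lam A oo lam B"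
    unfolding bullet_def by (rule inv_into_into, rule f_inv_into_f)
qed

lemma power_seq_in_seqs: "power_seq x \<in> seqs"
  by (simp add: power_seq_def seqs_def)

lemma interp_invert_ogf:
  "(1 - fps_const x * fps_X * Abs_fps A) * Abs_fps (interp_invert x A) = Abs_fps A"
proof -
  let ?f = "1 - fps_const x * fps_X * Abs_fps A"
  have "?f * fps_right_inverse ?f 1 = 1"
    by (rule fps_right_inverse) (simp add: mult.assoc)
  then show ?thesis
    by (simp add: interp_invert_def fps_nth_inverse mult.left_commute)
qed

lemma interp_invert_in_seqs: "A \<in> seqs \<Longrightarrow> interp_invert x A \<in> seqs"
  by (simp add: interp_invert_def seqs_def)

lemma interp_binomial_in_seqs: "A \<in> seqs \<Longrightarrow> interp_binomial x A \<in> seqs"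
  by (simp add: interp_binomial_def seqs_def)

end

theory Submission
  imports Defs
begin

text \<open>
  Let \<open>g = t + x t\<^sup>2 + x\<^sup>2 t\<^sup>3 + \<dots>\<close> be the series of \<open>X(x)\<close>. Everything follows from its
  functional equation \<open>g = t (1 + x g)\<close>, which is \<open>lam_power_seq\<close>.

  Substituting \<open>s = \<lambda>(A)\<close> for \<open>t\<close> gives \<open>g \<circ> s = s + x s (g \<circ> s)\<close>, that is
  \<open>(1 - x s) (g \<circ> s) = s\<close>. The shifted generating function of \<open>I\<^sup>(\<^sup>x\<^sup>)(A)\<close> satisfies the same linear
  equation by definition, and \<open>1 - x s\<close> is a unit, so the two series agree: this is
  \<open>lam_interp_invert\<close>.

  Multiplying the functional equation by \<open>g\<^sup>j\<close> gives \<open>g\<^sup>j\<^sup>+\<^sup>1 = t (g\<^sup>j + x g\<^sup>j\<^sup>+\<^sup>1)\<close>. On coefficients this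
  is Pascal's rule weighted by \<open>x\<close>, so the coefficient of \<open>t\<^sup>n\<^sup>+\<^sup>1\<close> in \<open>g\<^sup>j\<^sup>+\<^sup>1\<close> is
  \<open>(n choose j) x\<^sup>n\<^sup>-\<^sup>j\<close>. Reading off the coefficients of \<open>\<lambda>(A) \<circ> g = (\<Sum>j. a\<^sub>j g\<^sup>j\<^sup>+\<^sup>1)\<close> gives the
  Binomial transform: this is \<open>lam_interp_binomial\<close>.

  Both identities descend from series to sequences because \<open>lam\<close> is injective on \<open>seqs\<close>.
\<close>

lemma lam_nth [simp]:
  "lam A $ 0 = 0" "lam A $ Suc n = A n"
  by (simp_all add: lam_def)

lemma lam_eq_fps_X_mult: "lam A = fps_X * Abs_fps A"
  by (rule fps_ext) (simp add: lam_def split: nat.split)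

lemma lam_power_seq: "lam (power_seq x) = fps_X + fps_const x * (fps_X * lam (power_seq x))"
proof (rule fps_ext)
  fix n
  show "lam (power_seq x) $ n = (fps_X + fps_const x * (fps_X * lam (power_seq x))) $ n"
    by (cases n; cases "n - 1") (auto simp: power_seq_def)
qed

text \<open>Since \<open>s\<^sup>i\<close> has no terms of degree below \<open>i\<close>, the sums for the coefficients of \<open>f \<circ> s\<close> up to
  degree \<open>n\<close> can all be taken over the same range \<open>0..n\<close>. They can then be exchanged with the
  convolution by \<open>s\<close>, which is an argument over any commutative ring.\<close>

lemma fps_X_mult_compose:
  fixes f s :: "'a::comm_ring_1 fps"
  assumes "s $ 0 = 0"
  shows "(fps_X * f) oo s = s * (f oo s)"
proof (rule fps_ext)
  fix n
  have prefix: "s ^ i $ m = 0" if "m < i" for i m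
    using startsby_zero_power_prefix[OF assms] that by blast
  have widen: "(f oo s) $ (n - k) = (\<Sum>i=0..n. f $ i * s ^ i $ (n - k))" if "k \<le> n" for k
    unfolding fps_compose_nth by (rule sum.mono_neutral_left) (auto simp: prefix)
  have "(s * (f oo s)) $ n = (\<Sum>k=0..n. \<Sum>i=0..n. f $ i * (s $ k * s ^ i $ (n - k)))"
    by (simp add: fps_mult_nth widen sum_distrib_left mult.left_commute)
  also have "\<dots> = (\<Sum>i=0..n. f $ i * s ^ Suc i $ n)"
    by (subst sum.swap) (simp add: fps_mult_nth sum_distrib_left)
  also have "\<dots> = (\<Sum>i=0..Suc n. (fps_X * f) $ i * s ^ i $ n)"
    unfolding sum.atLeast0_atMost_Suc_shift by (simp del: power_Suc)
  also have "\<dots> = (\<Sum>i=0..n. (fps_X * f) $ i * s ^ i $ n)"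
    by (simp add: prefix del: power_Suc)
  finally show "((fps_X * f) oo s) $ n = (s * (f oo s)) $ n"
    by (simp add: fps_compose_nth)
qed

lemma fps_const_mult_compose:
  fixes f s :: "'a::comm_ring_1 fps"
  shows "(fps_const c * f) oo s = fps_const c * (f oo s)"
  by (rule fps_ext) (simp add: fps_compose_nth sum_distrib_left mult.assoc)

lemma lam_interp_invert: "lam (interp_invert x A) = lam (power_seq x) oo lam A"
proof -
  let ?g = "lam (power_seq x)" and ?s = "lam A" and ?u = "1 - fps_const x * lam A"
  have "?g oo ?s = ?s + fps_const x * (?s * (?g oo ?s))"
    by (subst lam_power_seq)
      (simp add: fps_compose_add_distrib fps_const_mult_compose fps_X_mult_compose)
  then have comp: "?u * (?g oo ?s) = ?s"
    by (simp add: algebra_simps)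
  have "?u * lam (interp_invert x A)
      = fps_X * ((1 - fps_const x * fps_X * Abs_fps A) * Abs_fps (interp_invert x A))"
    by (simp add: lam_eq_fps_X_mult mult_ac)
  then have "?u * lam (interp_invert x A) = ?s"
    by (simp only: interp_invert_ogf lam_eq_fps_X_mult)
  with comp have "?u * lam (interp_invert x A) = ?u * (?g oo ?s)"
    by simp
  \<comment> \<open>Zero divisors are allowed, so \<open>?u\<close> is cancelled by its inverse and not as a nonzero factor.\<close>
  then have "(fps_left_inverse ?u 1 * ?u) * lam (interp_invert x A)
      = (fps_left_inverse ?u 1 * ?u) * (?g oo ?s)"
    by (simp only: mult.assoc)
  moreover have "fps_left_inverse ?u 1 * ?u = 1"
    by (rule fps_left_inverse) simp
  ultimately show ?thesis
    by simp
qed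

text \<open>Pascal's rule in the guise of a functional equation: a factor \<open>t\<close> is split off from one of the
  \<open>j + 1\<close> factors \<open>g = t (1 + x g)\<close>.\<close>

lemma lam_power_seq_power_nth_Suc:
  fixes x :: "'a::comm_ring_1"
  defines "g \<equiv> lam (power_seq x)"
  shows "g ^ Suc j $ Suc n = g ^ j $ n + x * g ^ Suc j $ n"
proof -
  have "g ^ Suc j = fps_X * (g ^ j + fps_const x * g ^ Suc j)"
    using arg_cong[OF lam_power_seq[of x], of "\<lambda>f. f * g ^ j"]
    by (simp add: g_def algebra_simps)
  from arg_cong[OF this, of "\<lambda>f. f $ Suc n"] show ?thesis
    by (simp del: power_Suc)
qed

lemma lam_power_seq_power_nth:
  "lam (power_seq x) ^ Suc j $ Suc n = of_nat (n choose j) * x ^ (n - j)"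
proof (induction n arbitrary: j)
  case 0
  have "power_seq x 0 = 1"
    by (simp add: power_seq_def)
  then show ?case
    by (cases j) (simp_all add: lam_power_seq_power_nth_Suc fps_nth_power_0 del: power_Suc)
next
  case (Suc n)
  show ?case
  proof (cases j)
    case 0
    then show ?thesis
      using Suc.IH[of 0] lam_power_seq_power_nth_Suc[of x 0 "Suc n"] by simp
  next
    case j: (Suc i)
    \<comment> \<open>For \<open>i \<ge> n\<close> the difference \<open>n - Suc i\<close> is truncated, but the binomial coefficient vanishes.\<close>
    have "x * (of_nat (n choose Suc i) * x ^ (n - Suc i)) = of_nat (n choose Suc i) * x ^ (n - i)"
    proof (cases "i < n")
      case True
      then have "x ^ (n - i) = x * x ^ (n - Suc i)"
        by (simp add: Suc_diff_Suc flip: power_Suc)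
      then show ?thesis
        by (simp add: mult_ac)
    qed (simp add: binomial_eq_0)
    then show ?thesis
      using Suc.IH[of i] Suc.IH[of "Suc i"]
      by (simp add: j lam_power_seq_power_nth_Suc algebra_simps del: power_Suc)
  qed
qed

lemma lam_interp_binomial: "lam (interp_binomial x A) = lam A oo lam (power_seq x)"
proof (rule fps_ext)
  fix n
  show "lam (interp_binomial x A) $ n = (lam A oo lam (power_seq x)) $ n"
  proof (cases n)
    case (Suc m)
    have "(lam A oo lam (power_seq x)) $ Suc m
        = (\<Sum>j=0..m. A j * lam (power_seq x) ^ Suc j $ Suc m)"
      unfolding fps_compose_nth by (subst sum.atLeast0_atMost_Suc_shift) (simp del: power_Suc)
    also have "\<dots> = interp_binomial x A m"
      by (simp add: lam_power_seq_power_nth interp_binomial_def mult_ac del: power_Suc)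
    finally show ?thesis
      using Suc by simp
  qed simp
qed

lemma bullet_eqI:
  assumes "C \<in> seqs" "lam C = lam A oo lam B"
  shows "A \<bullet>\<^sub>S B = C"
  unfolding bullet_def assms(2)[symmetric]
  using bij_betw_imp_inj_on[OF bij_betw_lam] assms(1) by (rule inv_into_f_f)

theorem theorem1p15:
  fixes x :: "'a::comm_ring_1"
  shows "restrict (interp_invert x) seqs = restrict (left_mult (power_seq x)) seqs \<and>
         restrict (interp_binomial x) seqs = restrict (right_mult (power_seq x)) seqs"
proof (intro conjI restrict_ext)
  fix A :: "nat \<Rightarrow> 'a"
  assume A: "A \<in> seqs"
  show "interp_invert x A = left_mult (power_seq x) A"
    using bullet_eqI[OF interp_invert_in_seqs[OF A] lam_interp_invert]
    by (simp add: left_mult_def)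
  show "interp_binomial x A = right_mult (power_seq x) A"
    using bullet_eqI[OF interp_binomial_in_seqs[OF A] lam_interp_binomial]
    by (simp add: right_mult_def)
qed

end
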